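(* Let $A=x+iy$ be a complex octonion, with $x,y$ two real octonions, and let $a=q_1+q_2k$ be a real octonion, with $q_1,q_2$ two real quaternions. Then: (i) $T\,\Lambda(a)\,T=\Delta(a^{+})$, where $T=\begin{pmatrix} M_1 & O_4\\ O_4 & I_4\end{pmatrix}\in\mathcal{M}_8(\mathbb{R})$, $I_4$ is the $4\times4$ identity matrix and $O_4$ is the $4\times 4$ zero matrix. (ii) $S\,\Phi(A)\,S=\Psi(A^{+})$, where $A^{+}=x^{+}+iy^{+}$, $S=\begin{pmatrix} T & O_8\\ O_8 & T\end{pmatrix}\in\mathcal{M}_{16}(\mathbb{R})$ and $O_8$ is the $8\times 8$ zero matrix.
   Context: $\mathbb{H}$ is the real quaternion division algebra with basis $1,i,j,ij$ ($i^2=j^2=-1$, $ij=-ji$). For $q=a_0+a_1i+a_2j+a_3ij\in\mathbb{H}$ put $\overline q=a_0-a_1i-a_2j-a_3ij$, $q^{*}=a_0+a_1i-a_2j-a_3ij$, and $$\lambda(q)=\begin{pmatrix} a_0&-a_1&-a_2&-a_3\\ a_1&a_0&-a_3&a_2\\ a_2&a_3&a_0&-a_1\\ a_3&-a_2&a_1&a_0\end{pmatrix},\qquad \rho(q)=\begin{pmatrix} a_0&-a_1&-a_2&-a_3\\ a_1&a_0&a_3&-a_2\\ a_2&-a_3&a_0&a_1\\ a_3&a_2&-a_1&a_0\end{pmatrix}.$$ $\mathbb{O}$ is the real octonion division algebra; every $a\in\mathbb{O}$ is written uniquely as $a=q_1+q_2k$ with $q_1,q_2\in\mathbb{H}$,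 the product being $(p_1+p_2k)(q_1+q_2k)=(p_1q_1-\overline{q_2}p_2)+(q_2p_1+p_2\overline{q_1})k$. For $a=q_1+q_2k$ put $a^{*}=q_1^{*}-q_2k$ and $a^{+}=\overline{q_1}+q_2k$. Let $M_1=\mathrm{diag}(1,-1,-1,-1)$ and $$\Lambda(a)=\begin{pmatrix}\lambda(q_1)&-\rho(q_2)M_1\\ \lambda(q_2)M_1&\rho(q_1)\end{pmatrix},\qquad \Delta(a)=\begin{pmatrix}\rho(q_1)&-\lambda(\overline{q_2})\\ \lambda(q_2)&\rho(\overline{q_1})\end{pmatrix}\in\mathcal{M}_8(\mathbb{R}).$$ A complex octonion is an octonion with complex coefficients (in the octonion basis $1,e_1,\dots,e_7$); it is written uniquely as $A=x+iy$ with $x,y\in\mathbb{O}$, where here $i$ is the imaginary unit of $\mathbb{C}$. Its left and right real matrix representations are $$\Phi(A)=\begin{pmatrix}\Lambda(x)&-\Lambda(y)\\ \Lambda(y^{*})&\Lambda(x^{*})\end{pmatrix},\qquad \Psi(A)=\begin{pmatrix}\Delta(x)&-\Delta(y)\\ \Delta(y^{*})&\Delta(x^{*})\end{pmatrix}\in\mathcal{M}_{16}(\mathbb{R}).$$ *)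

theory Defs
  imports Complex_Main "Jordan_Normal_Form.Matrix"
begin

section \<open>Quaternions\<close>

text \<open>
  The coefficient ring is a parameter: \<open>real quat\<close> is the division algebra of real quaternions.
  \<open>Quat a0 a1 a2 a3\<close> stands for \<open>a0 + a1 i + a2 j + a3 ij\<close>.
\<close>

datatype 'a quat = Quat (coef0: 'a) (coef1: 'a) (coef2: 'a) (coef3: 'a)

instantiation quat :: (zero) zero
begin
definition zero_quat :: "'a quat" where "0 = Quat 0 0 0 0"
instance ..
end

instantiation quat :: ("{zero, one}") one
begin
definition one_quat :: "'a quat" where "1 = Quat 1 0 0 0"
instance ..
end

instantiation quat :: (plus) plus
begin
definition plus_quat :: "'a quat \<Rightarrow> 'a quat \<Rightarrow> 'a quat" where
  "p + q = Quat (coef0 p + coef0 q) (coef1 p + coef1 q) (coef2 p + coef2 q) (coef3 p + coef3 q)"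
instance ..
end

instantiation quat :: (uminus) uminus
begin
definition uminus_quat :: "'a quat \<Rightarrow> 'a quat" where
  "- q = Quat (- coef0 q) (- coef1 q) (- coef2 q) (- coef3 q)"
instance ..
end

instantiation quat :: (minus) minus
begin
definition minus_quat :: "'a quat \<Rightarrow> 'a quat \<Rightarrow> 'a quat" where
  "p - q = Quat (coef0 p - coef0 q) (coef1 p - coef1 q) (coef2 p - coef2 q) (coef3 p - coef3 q)"
instance ..
end

instantiation quat :: (ring) times
begin
definition times_quat :: "'a quat \<Rightarrow> 'a quat \<Rightarrow> 'a quat" where
  "p * q = Quat
     (coef0 p * coef0 q - coef1 p * coef1 q - coef2 p * coef2 q - coef3 p * coef3 q)
     (coef0 p * coef1 q + coef1 p * coef0 q + coef2 p * coef3 q - coef3 p * coef2 q)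
     (coef0 p * coef2 q - coef1 p * coef3 q + coef2 p * coef0 q + coef3 p * coef1 q)
     (coef0 p * coef3 q + coef1 p * coef2 q - coef2 p * coef1 q + coef3 p * coef0 q)"
instance ..
end

lemmas quat_defs = zero_quat_def one_quat_def plus_quat_def uminus_quat_def minus_quat_def
  times_quat_def

instance quat :: (comm_ring_1) ring_1
  by standard (auto simp: quat_defs quat.expand algebra_simps)

definition quat_i :: "'a::{zero,one} quat" where "quat_i = Quat 0 1 0 0"
definition quat_j :: "'a::{zero,one} quat" where "quat_j = Quat 0 0 1 0"

lemma quat_relations:
  "quat_i * quat_i = (- 1 :: 'a::ring_1 quat)"
  "quat_j * quat_j = (- 1 :: 'a::ring_1 quat)"
  "quat_i * quat_j = (Quat 0 0 0 1 :: 'a::ring_1 quat)"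
  "quat_i * quat_j = - (quat_j * quat_i :: 'a::ring_1 quat)"
  by (simp_all add: quat_defs quat_i_def quat_j_def)

definition quat_cnj :: "'a::uminus quat \<Rightarrow> 'a quat" where
  "quat_cnj q = Quat (coef0 q) (- coef1 q) (- coef2 q) (- coef3 q)"

definition quat_star :: "'a::uminus quat \<Rightarrow> 'a quat" where
  "quat_star q = Quat (coef0 q) (coef1 q) (- coef2 q) (- coef3 q)"


section \<open>Octonions\<close>

text \<open>
  \<open>Oct q1 q2\<close> stands for \<open>q1 + q2 k\<close>. Over the reals this is the division algebra of real
  octonions. Over the complex numbers the product is the complex-bilinear extension of the real
  one, since \<^const>\<open>quat_cnj\<close> does not conjugate coefficients.
\<close>

datatype 'a oct = Oct (quat1: "'a quat") (quat2: "'a quat")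

type_synonym octonion = "real oct"
type_synonym complex_octonion = "complex oct"

instantiation oct :: (zero) zero
begin
definition zero_oct :: "'a oct" where "0 = Oct 0 0"
instance ..
end

instantiation oct :: ("{zero, one}") one
begin
definition one_oct :: "'a oct" where "1 = Oct 1 0"
instance ..
end

instantiation oct :: (plus) plus
begin
definition plus_oct :: "'a oct \<Rightarrow> 'a oct \<Rightarrow> 'a oct" where
  "a + b = Oct (quat1 a + quat1 b) (quat2 a + quat2 b)"
instance ..
end

instantiation oct :: (uminus) uminus
begin
definition uminus_oct :: "'a oct \<Rightarrow> 'a oct" where
  "- a = Oct (- quat1 a) (- quat2 a)"
instance ..
end

instantiation oct :: (minus) minus
begin
definition minus_oct :: "'a oct \<Rightarrow> 'a oct \<Rightarrow> 'a oct" where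
  "a - b = Oct (quat1 a - quat1 b) (quat2 a - quat2 b)"
instance ..
end

instantiation oct :: (ring) times
begin
definition times_oct :: "'a oct \<Rightarrow> 'a oct \<Rightarrow> 'a oct" where
  "a * b = Oct (quat1 a * quat1 b - quat_cnj (quat2 b) * quat2 a)
               (quat2 b * quat1 a + quat2 a * quat_cnj (quat1 b))"
instance ..
end

lemmas oct_defs = zero_oct_def one_oct_def plus_oct_def uminus_oct_def minus_oct_def times_oct_def

instance oct :: (ab_group_add) ab_group_add
  by standard (auto simp: oct_defs quat_defs algebra_simps quat.expand)

definition of_quat :: "'a::zero quat \<Rightarrow> 'a oct" where "of_quat q = Oct q 0"
definition oct_k :: "'a::{zero,one} oct" where "oct_k = Oct 0 1"

lemma of_quat_plus_of_quat_times_k: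
  "of_quat p + of_quat q * oct_k = (Oct p q :: 'a::comm_ring_1 oct)"
  by (simp add: of_quat_def oct_k_def oct_defs quat_cnj_def quat_defs)

definition oct_star :: "'a::ring_1 oct \<Rightarrow> 'a oct" where
  "oct_star a = of_quat (quat_star (quat1 a)) - of_quat (quat2 a) * oct_k"

definition oct_plus :: "'a::ring_1 oct \<Rightarrow> 'a oct" where
  "oct_plus a = of_quat (quat_cnj (quat1 a)) + of_quat (quat2 a) * oct_k"


section \<open>Complex octonions\<close>

definition oct_scale :: "'a::times \<Rightarrow> 'a oct \<Rightarrow> 'a oct" where
  "oct_scale c = map_oct (\<lambda>t. c * t)"

text \<open>
  The octonion \<open>x + \<i> y\<close>, where \<open>\<i>\<close> is the complex unit acting on coefficients; it is
  different from the quaternion unit \<^const>\<open>quat_i\<close>.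
\<close>

definition coct :: "octonion \<Rightarrow> octonion \<Rightarrow> complex_octonion" where
  "coct x y = map_oct of_real x + oct_scale \<i> (map_oct of_real y)"

definition Re_oct :: "complex_octonion \<Rightarrow> octonion" where "Re_oct = map_oct Re"
definition Im_oct :: "complex_octonion \<Rightarrow> octonion" where "Im_oct = map_oct Im"

lemma Re_oct_coct [simp]: "Re_oct (coct x y) = x"
  and Im_oct_coct [simp]: "Im_oct (coct x y) = y"
  by (simp_all add: coct_def Re_oct_def Im_oct_def oct_scale_def oct_defs quat_defs
      oct.expand quat.expand oct.map_sel quat.map_sel)

lemma coct_Re_Im: "coct (Re_oct A) (Im_oct A) = A"
  by (simp add: coct_def Re_oct_def Im_oct_def oct_scale_def oct_defs quat_defs
      oct.expand quat.expand oct.map_sel quat.map_sel complex_eq_iff)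


section \<open>Real matrix representations\<close>

definition lambda_mat :: "real quat \<Rightarrow> real mat" where
  "lambda_mat q = (let a0 = coef0 q; a1 = coef1 q; a2 = coef2 q; a3 = coef3 q in
     mat_of_rows_list 4
      [[a0, - a1, - a2, - a3],
       [a1,   a0, - a3,   a2],
       [a2,   a3,   a0, - a1],
       [a3, - a2,   a1,   a0]])"

definition rho_mat :: "real quat \<Rightarrow> real mat" where
  "rho_mat q = (let a0 = coef0 q; a1 = coef1 q; a2 = coef2 q; a3 = coef3 q in
     mat_of_rows_list 4
      [[a0, - a1, - a2, - a3],
       [a1,   a0,   a3, - a2],
       [a2, - a3,   a0,   a1],
       [a3,   a2, - a1,   a0]])"

definition M1 :: "real mat" where
  "M1 = mat_diag 4 (\<lambda>i. if i = 0 then 1 else - 1)"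

definition Lambda_mat :: "octonion \<Rightarrow> real mat" where
  "Lambda_mat a = four_block_mat
     (lambda_mat (quat1 a))      (- (rho_mat (quat2 a) * M1))
     (lambda_mat (quat2 a) * M1) (rho_mat (quat1 a))"

definition Delta_mat :: "octonion \<Rightarrow> real mat" where
  "Delta_mat a = four_block_mat
     (rho_mat (quat1 a))    (- lambda_mat (quat_cnj (quat2 a)))
     (lambda_mat (quat2 a)) (rho_mat (quat_cnj (quat1 a)))"

definition Phi_mat :: "complex_octonion \<Rightarrow> real mat" where
  "Phi_mat A = (let x = Re_oct A; y = Im_oct A in four_block_mat
     (Lambda_mat x)            (- Lambda_mat y)
     (Lambda_mat (oct_star y)) (Lambda_mat (oct_star x)))"

definition Psi_mat :: "complex_octonion \<Rightarrow> real mat" where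
  "Psi_mat A = (let x = Re_oct A; y = Im_oct A in four_block_mat
     (Delta_mat x)            (- Delta_mat y)
     (Delta_mat (oct_star y)) (Delta_mat (oct_star x)))"

definition T_mat :: "real mat" where
  "T_mat = four_block_mat M1 (0\<^sub>m 4 4) (0\<^sub>m 4 4) (1\<^sub>m 4)"

definition S_mat :: "real mat" where
  "S_mat = four_block_mat T_mat (0\<^sub>m 8 8) (0\<^sub>m 8 8) T_mat"

lemma mat_carriers [simp]:
  "lambda_mat q \<in> carrier_mat 4 4" "rho_mat q \<in> carrier_mat 4 4" "M1 \<in> carrier_mat 4 4"
  "Lambda_mat a \<in> carrier_mat 8 8" "Delta_mat a \<in> carrier_mat 8 8" "T_mat \<in> carrier_mat 8 8"
  "Phi_mat A \<in> carrier_mat 16 16" "Psi_mat A \<in> carrier_mat 16 16" "S_mat \<in> carrier_mat 16 16"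
proof -
  show c4: "lambda_mat q \<in> carrier_mat 4 4" "rho_mat q \<in> carrier_mat 4 4"
    "M1 \<in> carrier_mat 4 4" for q
    by (simp_all add: lambda_mat_def rho_mat_def M1_def Let_def mat_of_rows_list_def numeral_eq_Suc)
  have block: "four_block_mat P Q R U \<in> carrier_mat (2 * n) (2 * n)"
    if "P \<in> carrier_mat n n" "U \<in> carrier_mat n n" for P Q R U :: "real mat" and n
    using four_block_carrier_mat[OF that, of Q R] by (simp add: mult_2)
  show c8: "Lambda_mat a \<in> carrier_mat 8 8" "Delta_mat a \<in> carrier_mat 8 8"
    "T_mat \<in> carrier_mat 8 8" for a
    using block[of _ 4] c4 by (auto simp: Lambda_mat_def Delta_mat_def T_mat_def)
  show "Phi_mat A \<in> carrier_mat 16 16" "Psi_mat A \<in> carrier_mat 16 16"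
    "S_mat \<in> carrier_mat 16 16"
    using block[of _ 8] c8 by (auto simp: Phi_mat_def Psi_mat_def S_mat_def Let_def)
qed

end

theory Submission
  imports Defs
begin

text \<open>
  \<^const>\<open>M1\<close> is the matrix of quaternion conjugation, which reverses products, so conjugating by it
  exchanges left and right multiplication: \<open>M1 \<lambda>(q) M1 = \<rho>(q')\<close> with \<open>q'\<close> the conjugate
  of \<open>q\<close>. Block multiplication then gives (i), and (ii) follows blockwise from (i) because the
  involutions \<open>a\<^sup>*\<close> and \<open>a\<^sup>+\<close> commute.
\<close>

text \<open>Applied with n = m = 4 to \<open>T_mat\<close> and with n = m = 8 to
  \<open>S_mat\<close>; each block is multiplied on the left by its row's factor and on the right by
  its column's.\<close>

lemma block_diag_conj:
  fixes P Q A B C D :: "'a::semiring_1 mat"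
  assumes "P \<in> carrier_mat n n" "Q \<in> carrier_mat m m"
    and "A \<in> carrier_mat n n" "B \<in> carrier_mat n m" "C \<in> carrier_mat m n" "D \<in> carrier_mat m m"
  shows "four_block_mat P (0\<^sub>m n m) (0\<^sub>m m n) Q * four_block_mat A B C D *
      four_block_mat P (0\<^sub>m n m) (0\<^sub>m m n) Q =
    four_block_mat (P * A * P) (P * B * Q) (Q * C * P) (Q * D * Q)"
proof -
  have "four_block_mat P (0\<^sub>m n m) (0\<^sub>m m n) Q * four_block_mat A B C D =
    four_block_mat (P * A) (P * B) (Q * C) (Q * D)"
    using assms by (subst mult_four_block_mat[of _ n n _ m _ m _ _ n _ m]) auto
  also have "\<dots> * four_block_mat P (0\<^sub>m n m) (0\<^sub>m m n) Q =
    four_block_mat (P * A * P) (P * B * Q) (Q * C * P) (Q * D * Q)"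
    using assms by (subst mult_four_block_mat[of _ n n _ m _ m _ _ n _ m]) auto
  finally show ?thesis .
qed

lemma quat_cnj_cnj [simp]: "quat_cnj (quat_cnj q) = (q :: 'a::group_add quat)"
  by (simp add: quat_cnj_def)

lemma oct_plus_eq: "oct_plus a = (Oct (quat_cnj (quat1 a)) (quat2 a) :: 'a::comm_ring_1 oct)"
  by (simp add: oct_plus_def of_quat_plus_of_quat_times_k)

lemma oct_star_eq: "oct_star a = (Oct (quat_star (quat1 a)) (- quat2 a) :: 'a::comm_ring_1 oct)"
  by (simp add: oct_star_def of_quat_def oct_k_def oct_defs quat_cnj_def quat_defs)

lemma oct_star_oct_plus: "oct_star (oct_plus a) = oct_plus (oct_star (a :: 'a::comm_ring_1 oct))"
  by (simp add: oct_plus_eq oct_star_eq quat_cnj_def quat_star_def)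

lemma mat_dims [simp]:
  "dim_row (lambda_mat q) = 4" "dim_col (lambda_mat q) = 4"
  "dim_row (rho_mat q) = 4" "dim_col (rho_mat q) = 4"
  "dim_row M1 = 4" "dim_col M1 = 4"
  "dim_row (Lambda_mat a) = 8" "dim_col (Lambda_mat a) = 8"
  "dim_row T_mat = 8" "dim_col T_mat = 8"
  by (simp_all only: carrier_matD[OF mat_carriers(1)] carrier_matD[OF mat_carriers(2)]
      carrier_matD[OF mat_carriers(3)] carrier_matD[OF mat_carriers(4)] carrier_matD[OF mat_carriers(6)])

lemma M1_square: "M1 * M1 = 1\<^sub>m 4"
  unfolding M1_def mat_diag_diag by (rule eq_matI) (auto simp: mat_diag_def)

lemma M1_lambda_M1: "M1 * lambda_mat q * M1 = rho_mat (quat_cnj q)"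
proof -
  have "M1 * lambda_mat q = mat 4 4 (\<lambda>(i, j). (if i = 0 then 1 else - 1) * lambda_mat q $$ (i, j))"
    unfolding M1_def by (rule mat_diag_mult_left) simp
  moreover have "\<dots> * M1 = mat 4 4 (\<lambda>(i, j). (if i = 0 then 1 else - 1) * lambda_mat q $$ (i, j) *
      (if j = 0 then 1 else - 1))"
    unfolding M1_def by (subst mat_diag_mult_right[of _ 4]) (auto intro!: eq_matI)
  \<comment> \<open>The signs flip only the first row and column off the corner; on the lower right
    3x3 block \<open>lambda_mat q\<close> and \<open>rho_mat (quat_cnj q)\<close> already
    agree.\<close>
  moreover have "\<dots> = rho_mat (quat_cnj q)"
    by (rule eq_matI)
      (auto simp: lambda_mat_def rho_mat_def quat_cnj_def Let_def mat_of_rows_list_def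
        less_Suc_eq numeral_eq_Suc)
  ultimately show ?thesis by simp
qed

text \<open>Inverts \<open>M1_lambda_M1\<close>, taken at the conjugate of q, since
  \<open>M1\<close> is an involution.\<close>

lemma M1_rho_M1: "M1 * rho_mat q * M1 = lambda_mat (quat_cnj q)"
proof -
  have "rho_mat q = M1 * lambda_mat (quat_cnj q) * M1"
    by (simp add: M1_lambda_M1)
  also have "M1 * \<dots> * M1 = (M1 * M1) * lambda_mat (quat_cnj q) * (M1 * M1)"
    by (simp add: assoc_mult_mat[of _ 4 4 _ 4 _ 4] mult_carrier_mat[of _ 4 4 _ 4])
  also have "\<dots> = lambda_mat (quat_cnj q)"
    by (simp add: M1_square)
  finally show ?thesis .
qed

lemma T_Lambda_T: "T_mat * Lambda_mat a * T_mat = Delta_mat (oct_plus a)"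
proof -
  \<comment> \<open>The off-diagonal blocks of \<open>Lambda_mat\<close> meet \<open>M1\<close> only
    from the left. Here the \<open>M1\<close> inside the block supplies the right factor of the
    conjugation.\<close>
  have top: "M1 * (- (rho_mat q * M1)) = - lambda_mat (quat_cnj q)" for q
    by (simp add: M1_rho_M1[symmetric] assoc_mult_mat[of _ 4 4 _ 4 _ 4])
  \<comment> \<open>Here the \<open>M1\<close> from the first block column of \<open>T_mat\<close>
    cancels the one inside the block.\<close>
  have bottom: "lambda_mat q * M1 * M1 = lambda_mat q" for q
    by (simp add: M1_square assoc_mult_mat[of _ 4 4 _ 4 _ 4])
  show ?thesis
    unfolding T_mat_def Lambda_mat_def
    by (subst block_diag_conj)
      (auto simp: Delta_mat_def oct_plus_eq M1_lambda_M1 top bottom)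
qed

lemma S_Phi_S: "S_mat * Phi_mat (coct x y) * S_mat = Psi_mat (coct (oct_plus x) (oct_plus y))"
proof -
  have neg: "T_mat * (- Lambda_mat b) * T_mat = - Delta_mat (oct_plus b)" for b
  proof -
    have "T_mat * (- Lambda_mat b) * T_mat = - (T_mat * Lambda_mat b * T_mat)"
      by simp
    then show ?thesis by (simp add: T_Lambda_T)
  qed
  show ?thesis
    unfolding S_mat_def Phi_mat_def Let_def
    by (subst block_diag_conj)
      \<comment> \<open>In the lower blocks (i) yields \<open>oct_plus (oct_star x)\<close>, while
        \<open>Psi_mat\<close> asks for \<open>oct_star (oct_plus x)\<close>; likewise for
        y.\<close>
      (auto simp: Psi_mat_def T_Lambda_T neg oct_star_oct_plus)
qed

theorem proposition2p8:
  fixes A :: complex_octonion and x y a :: octonion and q1 q2 :: "real quat"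
  assumes "A = coct x y"
    and "a = of_quat q1 + of_quat q2 * oct_k"
  shows "T_mat * Lambda_mat a * T_mat = Delta_mat (oct_plus a) \<and>
    S_mat * Phi_mat A * S_mat = Psi_mat (coct (oct_plus x) (oct_plus y))"
  using assms(1) T_Lambda_T S_Phi_S by simp

end
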